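(* Let $A\in\mathbb{R}^{m\times n}$ have no zero rows, let $b\in\mathbb{R}^m$, and suppose that the feasible region $S=\{x\in\mathbb{R}^n : Ax\le b\}$ is nonempty. Let $\{\mathcal{I}_1,\dots,\mathcal{I}_t\}$ be a partition of $[m]$, put $$\zeta=\max_{1\le i\le t}\frac{\sigma_{\max}^2(A_{\mathcal{I}_i,:})}{\|A_{\mathcal{I}_i,:}\|_F^2},$$ and let $L>0$ be a Hoffman constant for $(A,b)$. Let $x^0\in\mathbb{R}^n$ and let $\{x^k\}_{k=0}^\infty$ be the random sequence generated by the GRABP method started at $x^0$ with constant stepsize $\alpha_k=\alpha$ for all $k$, where $\alpha\in(0,2/\zeta)$. Then for every $k\ge 0$, $$\mathbb{E}\left[\|x^k-P_S(x^k)\|_2^2\right]\le\left(1-\frac{2\alpha-\alpha^2\zeta}{L^2\|A\|_F^2}\right)^k\|x^0-P_S(x^0)\|_2^2 .$$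
   Context: Notation. $[m]=\{1,\dots,m\}$. The inequality $Ax\le b$ is componentwise. $\|\cdot\|_2$ is the Euclidean norm on vectors, $\|\cdot\|_F$ the Frobenius norm, and $\sigma_{\max}(G)$ the largest singular value of $G$. For $v\in\mathbb{R}^d$, $(v)_+$ is the vector with entries $\max\{0,v_j\}$. A partition $\{\mathcal{I}_1,\dots,\mathcal{I}_t\}$ of $[m]$ is a family of nonempty, pairwise disjoint index sets with union $[m]$. $A_{\mathcal{I}_i,:}$ is the row submatrix of $A$ indexed by $\mathcal{I}_i$, and $b_{\mathcal{I}_i}$ is the corresponding subvector of $b$. $P_S(x)$ is the orthogonal projection of $x$ onto the closed convex set $S$. Hoffman constant. By Hoffman's theorem there is a constant $L>0$ such that $\|x-P_S(x)\|_2^2\le L^2\|(Ax-b)_+\|_2^2$ for all $x\in\mathbb{R}^n$; any such $L$ is called a Hoffman constant for $(A,b)$. GRABP method (greedy randomized average block projection), for a fixed partition $\{\mathcal{I}_1,\dots,\mathcal{I}_t\}$ of $[m]$, initial point $x^0$ and stepsizes $\alpha_k$. Given $x^k\notin S$: (1) compute $$\epsilon_k=\frac12\left(\frac{1}{\|(Ax^k-b)_+\|_2^2}\max_{1\le i\le t}\frac{\|(A_{\mathcal{I}_i,:}x^k-b_{\mathcal{I}_i})_+\|_2^2}{\|A_{\mathcal{I}_i,:}\|_F^2}+\frac{1}{\|A\|_F^2}\right);$$ (2) let $\mathcal{U}_k=\{i\in\{1,\dots,t\} : \|(A_{\mathcal{I}_i,:}x^k-b_{\mathcal{I}_i})_+\|_2^2\ge\epsilon_k\|(Ax^k-b)_+\|_2^2\,\|A_{\mathcal{I}_i,:}\|_F^2\}$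 (this set is nonempty); (3) select a random index $i_k$ such that, conditionally on the first $k$ iterations, $i_k=i$ with probability $p_{k,i}$, where $p_{k,i}=0$ for $i\notin\mathcal{U}_k$, $p_{k,i}\ge0$ for $i\in\mathcal{U}_k$, and $\sum_{i\in\mathcal{U}_k}p_{k,i}=1$ (the probabilities are otherwise arbitrary and may depend on the past iterations); (4) set $$x^{k+1}=x^k-\alpha_k\frac{(A_{\mathcal{I}_{i_k},:})^\top(A_{\mathcal{I}_{i_k},:}x^k-b_{\mathcal{I}_{i_k}})_+}{\|A_{\mathcal{I}_{i_k},:}\|_F^2}.$$ If $x^k\in S$, then $x^{k+1}=x^k$. *)

theory Defs
  imports "HOL-Probability.Probability"
begin

definition feasible_region :: "real^'n^'m \<Rightarrow> real^'m \<Rightarrow> (real^'n) set" where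
  "feasible_region A b = {x. \<forall>j. (A *v x) $ j \<le> b $ j}"

definition pos_part :: "real^'m \<Rightarrow> real^'m" where
  "pos_part v = (\<chi> j. max 0 (v $ j))"

definition frobenius_norm :: "real^'n^'m \<Rightarrow> real" where
  "frobenius_norm G = sqrt (\<Sum>j\<in>UNIV. \<Sum>l\<in>UNIV. (G $ j $ l)\<^sup>2)"

lemma frobenius_norm_eq_norm: "frobenius_norm G = norm G"
  by (simp add: frobenius_norm_def norm_vec_def L2_set_def sum_nonneg)

text \<open>Square roots of the eigenvalues of the Gram matrix of \<open>G\<close>. Depending on its shape, this may
  include a zero that a listing of only min(m,n) singular values omits; the largest one is the same.\<close>
definition singular_values :: "real^'n^'m \<Rightarrow> real set" where
  "singular_values G = {sqrt \<mu> |\<mu>. \<exists>v. v \<noteq> 0 \<and> (transpose G ** G) *v v = \<mu> *\<^sub>R v}"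

definition sigma_max :: "real^'n^'m \<Rightarrow> real" where
  "sigma_max G = Max (singular_values G)"

text \<open>The submatrix of the rows in \<open>J\<close> and the corresponding subvector are padded with zeros, so
  that their row index type stays \<open>'m\<close>. The four lemmas below show that the padding affects neither
  the Gram matrix (hence the singular values, up to the remark above), nor the Frobenius norm, nor
  the terms of the method.\<close>
definition row_block :: "real^'n^'m \<Rightarrow> 'm set \<Rightarrow> real^'n^'m" where
  "row_block A J = (\<chi> j. if j \<in> J then A $ j else 0)"

definition vec_block :: "real^'m \<Rightarrow> 'm set \<Rightarrow> real^'m" where
  "vec_block b J = (\<chi> j. if j \<in> J then b $ j else 0)"

lemma gram_row_block:
  "(transpose (row_block A J) ** row_block A J) $ k $ l = (\<Sum>j\<in>J. A $ j $ k * A $ j $ l)"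
proof -
  have "(transpose (row_block A J) ** row_block A J) $ k $ l
      = (\<Sum>j\<in>UNIV. if j \<in> J then A $ j $ k * A $ j $ l else 0)"
    by (auto simp: matrix_matrix_mult_def transpose_def row_block_def intro!: sum.cong)
  then show ?thesis by (simp add: sum.If_cases)
qed

lemma frobenius_norm_row_block:
  "frobenius_norm (row_block A J) = sqrt (\<Sum>j\<in>J. \<Sum>l\<in>UNIV. (A $ j $ l)\<^sup>2)"
proof -
  have "(\<Sum>j\<in>UNIV. \<Sum>l\<in>UNIV. (row_block A J $ j $ l)\<^sup>2)
      = (\<Sum>j\<in>UNIV. if j \<in> J then (\<Sum>l\<in>UNIV. (A $ j $ l)\<^sup>2) else 0)"
    by (auto simp: row_block_def intro!: sum.cong)
  then show ?thesis by (simp add: frobenius_norm_def sum.If_cases)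
qed

lemma pos_part_row_block:
  "pos_part (row_block A J *v x - vec_block b J) $ j = (if j \<in> J then max 0 ((A *v x - b) $ j) else 0)"
  by (simp add: pos_part_def row_block_def vec_block_def matrix_vector_mult_def)

lemma transpose_row_block_mult:
  "transpose (row_block A J) *v v = (\<Sum>j\<in>J. v $ j *\<^sub>R A $ j)"
proof -
  have "(transpose (row_block A J) *v v) $ l = (\<Sum>j\<in>UNIV. if j \<in> J then v $ j * A $ j $ l else 0)" for l
    by (auto simp: matrix_vector_mult_def transpose_def row_block_def intro!: sum.cong)
  then show ?thesis by (simp add: vec_eq_iff sum.If_cases)
qed

definition hoffman_constant :: "real^'n^'m \<Rightarrow> real^'m \<Rightarrow> real \<Rightarrow> bool" where
  "hoffman_constant A b L \<longleftrightarrow> L > 0 \<and>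
     (\<forall>x. (norm (x - closest_point (feasible_region A b) x))\<^sup>2
        \<le> L\<^sup>2 * (norm (pos_part (A *v x - b)))\<^sup>2)"

definition grabp_eps :: "real^'n^'m \<Rightarrow> real^'m \<Rightarrow> nat \<Rightarrow> (nat \<Rightarrow> 'm set) \<Rightarrow> real^'n \<Rightarrow> real" where
  "grabp_eps A b t I x = 1 / 2 *
     (1 / (norm (pos_part (A *v x - b)))\<^sup>2 *
        Max ((\<lambda>i. (norm (pos_part (row_block A (I i) *v x - vec_block b (I i))))\<^sup>2
                  / (frobenius_norm (row_block A (I i)))\<^sup>2) ` {1..t})
      + 1 / (frobenius_norm A)\<^sup>2)"

definition grabp_candidates :: "real^'n^'m \<Rightarrow> real^'m \<Rightarrow> nat \<Rightarrow> (nat \<Rightarrow> 'm set) \<Rightarrow> real^'n \<Rightarrow> nat set" where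
  "grabp_candidates A b t I x =
     {i \<in> {1..t}. (norm (pos_part (row_block A (I i) *v x - vec_block b (I i))))\<^sup>2
        \<ge> grabp_eps A b t I x * (norm (pos_part (A *v x - b)))\<^sup>2 * (frobenius_norm (row_block A (I i)))\<^sup>2}"

definition grabp_step :: "real^'n^'m \<Rightarrow> real^'m \<Rightarrow> 'm set \<Rightarrow> real \<Rightarrow> real^'n \<Rightarrow> real^'n" where
  "grabp_step A b J \<alpha> x =
     x - (\<alpha> / (frobenius_norm (row_block A J))\<^sup>2) *\<^sub>R
         (transpose (row_block A J) *v pos_part (row_block A J *v x - vec_block b J))"

text \<open>The sigma-algebra generated by the indices drawn in the first \<open>k\<close> iterations, trivial for
  \<open>k = 0\<close>.\<close>
definition history :: "'w measure \<Rightarrow> (nat \<Rightarrow> 'w \<Rightarrow> nat) \<Rightarrow> nat \<Rightarrow> 'w measure" where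
  "history M idx k = sigma (space M) {idx l -` B \<inter> space M |l B. l < k}"

text \<open>\<open>idx k\<close> is the block index drawn in iteration \<open>k\<close> and \<open>p k i\<close> its history-dependent
  probability of being \<open>i\<close>. Once the iterate is feasible the index is not used, and nothing is
  required of its law.\<close>
locale grabp = prob_space M
  for M :: "'w measure"
    and A :: "real^'n^'m" and b :: "real^'m" and t :: nat and I :: "nat \<Rightarrow> 'm set"
    and \<alpha> :: "nat \<Rightarrow> real" and x0 :: "real^'n"
    and p :: "nat \<Rightarrow> nat \<Rightarrow> 'w \<Rightarrow> real" and idx :: "nat \<Rightarrow> 'w \<Rightarrow> nat"
    and x :: "nat \<Rightarrow> 'w \<Rightarrow> real^'n" +
  assumes idx_measurable: "\<And>k. idx k \<in> measurable M (count_space UNIV)"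
    and p_measurable: "\<And>k i. i \<in> {1..t} \<Longrightarrow> p k i \<in> borel_measurable (history M idx k)"
    and p_outside: "\<And>k i \<omega>. \<omega> \<in> space M \<Longrightarrow> x k \<omega> \<notin> feasible_region A b \<Longrightarrow>
          i \<in> {1..t} - grabp_candidates A b t I (x k \<omega>) \<Longrightarrow> p k i \<omega> = 0"
    and p_nonneg: "\<And>k i \<omega>. \<omega> \<in> space M \<Longrightarrow> x k \<omega> \<notin> feasible_region A b \<Longrightarrow>
          i \<in> grabp_candidates A b t I (x k \<omega>) \<Longrightarrow> p k i \<omega> \<ge> 0"
    and p_sum: "\<And>k \<omega>. \<omega> \<in> space M \<Longrightarrow> x k \<omega> \<notin> feasible_region A b \<Longrightarrow>
          (\<Sum>i\<in>grabp_candidates A b t I (x k \<omega>). p k i \<omega>) = 1"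
    and idx_law: "\<And>k i. i \<in> {1..t} \<Longrightarrow> AE \<omega> in M. x k \<omega> \<notin> feasible_region A b \<longrightarrow>
          real_cond_exp M (history M idx k) (indicator {\<omega> \<in> space M. idx k \<omega> = i}) \<omega> = p k i \<omega>"
    and x_init: "\<And>\<omega>. \<omega> \<in> space M \<Longrightarrow> x 0 \<omega> = x0"
    and x_step: "\<And>k \<omega>. \<omega> \<in> space M \<Longrightarrow> x (Suc k) \<omega> =
          (if x k \<omega> \<in> feasible_region A b then x k \<omega>
           else grabp_step A b (I (idx k \<omega>)) (\<alpha> k) (x k \<omega>))"

end

theory Submission
  imports Defs
begin

text \<open>
  Write \<open>d(x)\<close> for the squared distance of \<open>x\<close> to the feasible region \<open>S\<close>, \<open>r\<close> for the positive
  part of \<open>A x - b\<close>, \<open>r\<^sub>i\<close> for its restriction to the \<open>i\<close>-th block \<open>A\<^sub>i\<close>, and \<open>c\<close> for the asserted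
  contraction factor. The bound in expectation comes from a bound that holds on almost every path:
  whichever candidate block is used at an infeasible point, the step multiplies \<open>d\<close> by at most \<open>c\<close>.
  This is why the candidates may be weighted by arbitrary probabilities.

  Three estimates give the contraction (\<open>grabp_step_contracts\<close>).

  \<^item> Descent (\<open>grabp_step_descent\<close>): expand the square of the distance from the new iterate to
    \<open>y \<in> S\<close>. As \<open>A\<^sub>i y \<le> b\<^sub>i\<close> and \<open>r\<^sub>i \<ge> 0\<close>, the step direction has inner product at least
    \<open>\<parallel>r\<^sub>i\<parallel>\<^sup>2\<close> with \<open>x - y\<close>, and its squared length is at most \<open>\<sigma>\<^sub>m\<^sub>a\<^sub>x(A\<^sub>i)\<^sup>2 \<parallel>r\<^sub>i\<parallel>\<^sup>2\<close>. So the squared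
    distance drops by at least \<open>(2 \<alpha> - \<alpha>\<^sup>2 \<zeta>) \<parallel>r\<^sub>i\<parallel>\<^sup>2 / \<parallel>A\<^sub>i\<parallel>\<^sup>2\<close>, with Frobenius norms.

  \<^item> Greedy choice (\<open>candidate_residual_ge\<close>): the threshold for a candidate is half the sum of the
    largest ratio \<open>\<parallel>r\<^sub>i\<parallel>\<^sup>2 / \<parallel>A\<^sub>i\<parallel>\<^sup>2\<close> and of \<open>\<parallel>r\<parallel>\<^sup>2 / \<parallel>A\<parallel>\<^sup>2\<close>. The latter is an average of those ratios
    with weights proportional to \<open>\<parallel>A\<^sub>i\<parallel>\<^sup>2\<close>, so the ratio of a candidate is at least this average.

  \<^item> The Hoffman bound turns \<open>\<parallel>r\<parallel>\<^sup>2\<close> into \<open>d(x) / L\<^sup>2\<close>.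

  What is left to probability is that the drawn index is almost surely a candidate
  (\<open>AE_idx_in_candidates\<close>), which is deduced from its conditional law by integrating over events
  known before the draw. Induction over the iterations then bounds \<open>d\<close> almost surely by
  \<open>c ^ k d(x\<^sup>0)\<close>; this also gives integrability.
\<close>

section \<open>The largest singular value\<close>

lemma inner_transpose_matrix_vector:
  fixes G :: "real^'n^'m"
  shows "(transpose G *v u) \<bullet> v = u \<bullet> (G *v v)"
  by (simp add: transpose_matrix_vector dot_lmul_matrix)

lemma inner_gram:
  fixes G :: "real^'n^'m"
  shows "((transpose G ** G) *v v) \<bullet> w = (G *v v) \<bullet> (G *v w)"
  by (simp only: inner_transpose_matrix_vector flip: matrix_vector_mul_assoc)

text \<open>Eigenvectors of the symmetric Gram matrix for different eigenvalues are orthogonal, hence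
  linearly independent, and a finite-dimensional space has only finitely many of these. Finiteness
  is what makes the maximum in the definition of \<open>sigma_max\<close> meaningful.\<close>
lemma finite_gram_eigenvalues:
  fixes G :: "real^'n^'m"
  shows "finite {\<mu>. \<exists>v. v \<noteq> 0 \<and> (transpose G ** G) *v v = \<mu> *\<^sub>R v}" (is "finite ?E")
proof -
  obtain e where e: "\<And>\<mu>. \<mu> \<in> ?E \<Longrightarrow> e \<mu> \<noteq> 0 \<and> (transpose G ** G) *v e \<mu> = \<mu> *\<^sub>R e \<mu>"
  proof
    fix \<mu>
    assume "\<mu> \<in> ?E"
    then have "\<exists>v. v \<noteq> 0 \<and> (transpose G ** G) *v v = \<mu> *\<^sub>R v" by simp
    then show "(SOME v. v \<noteq> 0 \<and> (transpose G ** G) *v v = \<mu> *\<^sub>R v) \<noteq> 0 \<and>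
        (transpose G ** G) *v (SOME v. v \<noteq> 0 \<and> (transpose G ** G) *v v = \<mu> *\<^sub>R v)
          = \<mu> *\<^sub>R (SOME v. v \<noteq> 0 \<and> (transpose G ** G) *v v = \<mu> *\<^sub>R v)"
      by (rule someI_ex)
  qed
  have orth: "e \<mu> \<bullet> e \<nu> = 0" if "\<mu> \<in> ?E" "\<nu> \<in> ?E" "\<mu> \<noteq> \<nu>" for \<mu> \<nu>
  proof -
    have "\<mu> * (e \<mu> \<bullet> e \<nu>) = \<nu> * (e \<mu> \<bullet> e \<nu>)"
      using inner_gram[of G "e \<mu>" "e \<nu>"] inner_gram[of G "e \<nu>" "e \<mu>"] e[OF that(1)] e[OF that(2)]
      by (simp add: inner_commute)
    with that(3) show ?thesis by simp
  qed
  have inj: "inj_on e ?E"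
  proof (rule inj_onI, rule ccontr)
    fix \<mu> \<nu>
    assume *: "\<mu> \<in> ?E" "\<nu> \<in> ?E" "e \<mu> = e \<nu>" "\<mu> \<noteq> \<nu>"
    have "e \<mu> \<bullet> e \<mu> = 0"
      using orth[OF *(1,2,4)] *(3) by simp
    with e[OF *(1)] show False by simp
  qed
  have "pairwise orthogonal (e ` ?E)"
    by (rule pairwise_imageI) (unfold orthogonal_def, rule orth)
  moreover have "0 \<notin> e ` ?E"
    using e by fastforce
  ultimately have "independent (e ` ?E)"
    by (rule pairwise_orthogonal_independent)
  then have "finite (e ` ?E)"
    by (rule independent_imp_finite)
  with inj show ?thesis
    by (simp add: finite_image_iff)
qed

lemma finite_singular_values:
  fixes G :: "real^'n^'m"
  shows "finite (singular_values G)"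
proof -
  have "singular_values G = sqrt ` {\<mu>. \<exists>v. v \<noteq> 0 \<and> (transpose G ** G) *v v = \<mu> *\<^sub>R v}"
    by (auto simp: singular_values_def)
  then show ?thesis
    by (simp add: finite_gram_eigenvalues)
qed

text \<open>The operator norm of \<open>G\<close> is a singular value: the norm of \<open>G v\<close> attains its maximum on the
  compact unit sphere, and a maximizer is an eigenvector of the Gram matrix.\<close>
lemma singular_value_bounds_norm:
  fixes G :: "real^'n^'m"
  obtains \<mu> where "\<mu> \<ge> 0" "sqrt \<mu> \<in> singular_values G"
    and "\<And>u. (norm (G *v u))\<^sup>2 \<le> \<mu> * (norm u)\<^sup>2"
proof -
  have "compact (sphere (0::real^'n) 1)" "sphere (0::real^'n) 1 \<noteq> {}"
    by (auto simp: sphere_eq_empty)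
  moreover have "continuous_on (sphere 0 1) (\<lambda>v. norm (G *v v))"
    by (intro continuous_intros)
  ultimately obtain v where v: "norm v = 1" and vmax: "\<And>w. norm w = 1 \<Longrightarrow> norm (G *v w) \<le> norm (G *v v)"
    using continuous_attains_sup[of "sphere 0 1" "\<lambda>v. norm (G *v v)"]
    by (auto simp: sphere_def dist_norm)
  define \<mu> where "\<mu> = (norm (G *v v))\<^sup>2"
  have bound: "(norm (G *v u))\<^sup>2 \<le> \<mu> * (norm u)\<^sup>2" for u
  proof (cases "u = 0")
    case False
    have "norm (G *v u) = norm u * norm (G *v ((1 / norm u) *\<^sub>R u))"
      using False by (simp add: matrix_vector_mult_scaleR)
    also have "\<dots> \<le> norm u * norm (G *v v)"
      using False by (intro mult_left_mono vmax) auto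
    finally have "(norm (G *v u))\<^sup>2 \<le> (norm u * norm (G *v v))\<^sup>2"
      by (intro power_mono) auto
    then show ?thesis
      by (simp add: \<mu>_def power_mult_distrib mult.commute)
  qed simp
  \<comment> \<open>The quadratic form \<open>\<mu> \<parallel>w\<parallel>\<^sup>2 - \<parallel>G w\<parallel>\<^sup>2\<close> is nonnegative and vanishes at \<open>v\<close>, so its polar form
    vanishes at \<open>(v, w)\<close> for every \<open>w\<close>.\<close>
  have stationary: "\<mu> * (v \<bullet> w) - (G *v v) \<bullet> (G *v w) = 0" (is "?\<beta> = 0") for w
  proof -
    define \<beta> \<gamma> where "\<beta> = ?\<beta>" and "\<gamma> = \<mu> * (w \<bullet> w) - (G *v w) \<bullet> (G *v w)"
    have "\<gamma> \<ge> 0"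
      using bound[of w] by (simp add: \<gamma>_def power2_norm_eq_inner)
    have vv: "\<mu> * (v \<bullet> v) = (G *v v) \<bullet> (G *v v)"
      using v by (simp add: \<mu>_def norm_eq_1 power2_norm_eq_inner)
    have form: "0 \<le> 2 * s * \<beta> + s\<^sup>2 * \<gamma>" for s
      using bound[of "v + s *\<^sub>R w"] vv
      by (simp add: \<beta>_def \<gamma>_def power2_norm_eq_inner matrix_vector_right_distrib matrix_vector_mult_scaleR
          inner_commute[of w v] inner_commute[of "G *v w" "G *v v"] inner_simps)
         (simp add: algebra_simps power2_eq_square)
    \<comment> \<open>The natural choice \<open>- \<beta> / \<gamma>\<close> would minimize the form along this line; the shift avoids
      division by zero.\<close>
    define s where "s = - \<beta> / (\<gamma> + 1)"
    have s: "s * (\<gamma> + 1) = - \<beta>"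
      using \<open>\<gamma> \<ge> 0\<close> by (simp add: s_def)
    have "0 \<le> (2 * s * \<beta> + s\<^sup>2 * \<gamma>) * (\<gamma> + 1)\<^sup>2"
      by (intro mult_nonneg_nonneg form) simp
    also have "\<dots> = 2 * (s * (\<gamma> + 1)) * (\<gamma> + 1) * \<beta> + (s * (\<gamma> + 1))\<^sup>2 * \<gamma>"
      by (simp add: power2_eq_square algebra_simps)
    also have "\<dots> = - ((\<gamma> + 2) * \<beta>\<^sup>2)"
      unfolding s by (simp add: power2_eq_square algebra_simps)
    finally have "(\<gamma> + 2) * \<beta>\<^sup>2 \<le> 0"
      by simp
    then have "\<beta> = 0"
      using \<open>\<gamma> \<ge> 0\<close> by (simp add: mult_le_0_iff)
    then show ?thesis by (simp add: \<beta>_def)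
  qed
  have "((transpose G ** G) *v v) = \<mu> *\<^sub>R v"
  proof (rule vector_eq_ldot[THEN iffD1], rule allI)
    fix w
    show "w \<bullet> ((transpose G ** G) *v v) = w \<bullet> (\<mu> *\<^sub>R v)"
      using stationary[of w] inner_gram[of G v w] by (simp add: inner_commute)
  qed
  moreover have "v \<noteq> 0"
    using v by auto
  ultimately have "sqrt \<mu> \<in> singular_values G"
    by (auto simp: singular_values_def)
  with bound show ?thesis
    using that[of \<mu>] by (simp add: \<mu>_def)
qed

lemma norm_matrix_vector_le_sigma_max:
  fixes G :: "real^'n^'m"
  shows "norm (G *v u) \<le> sigma_max G * norm u" and "sigma_max G \<ge> 0"
proof -
  obtain \<mu> where \<mu>: "\<mu> \<ge> 0" "sqrt \<mu> \<in> singular_values G"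
    and bound: "\<And>u. (norm (G *v u))\<^sup>2 \<le> \<mu> * (norm u)\<^sup>2"
    using singular_value_bounds_norm[of G] by blast
  have le: "sqrt \<mu> \<le> sigma_max G"
    unfolding sigma_max_def by (rule Max_ge[OF finite_singular_values \<mu>(2)])
  have "norm (G *v u) \<le> sqrt \<mu> * norm u"
    using real_sqrt_le_mono[OF bound[of u]] by (simp add: real_sqrt_mult)
  also have "\<dots> \<le> sigma_max G * norm u"
    by (rule mult_right_mono[OF le]) simp
  finally show "norm (G *v u) \<le> sigma_max G * norm u" .
  show "sigma_max G \<ge> 0"
    using le \<mu>(1) real_sqrt_ge_zero[of \<mu>] by linarith
qed

text \<open>Transposing does not increase the operator norm: pair \<open>g = G\<^sup>T u\<close> with itself, move one
  factor \<open>G\<^sup>T\<close> to the other side, and cancel the norm of \<open>g\<close>.\<close>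
lemma norm_transpose_le_sigma_max:
  fixes G :: "real^'n^'m"
  shows "norm (transpose G *v u) \<le> sigma_max G * norm u"
proof (cases "transpose G *v u = 0")
  case True
  then show ?thesis by (simp add: norm_matrix_vector_le_sigma_max(2))
next
  case False
  let ?g = "transpose G *v u"
  have "norm ?g * norm ?g = u \<bullet> (G *v ?g)"
    by (simp only: flip: inner_transpose_matrix_vector power2_norm_eq_inner power2_eq_square)
  also have "\<dots> \<le> norm u * norm (G *v ?g)"
    by (rule norm_cauchy_schwarz)
  also have "\<dots> \<le> norm u * (sigma_max G * norm ?g)"
    by (intro mult_left_mono norm_matrix_vector_le_sigma_max) auto
  finally have "norm ?g * norm ?g \<le> (sigma_max G * norm u) * norm ?g"
    by (simp add: ac_simps)
  then show ?thesis
    using False by simp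
qed

section \<open>One step of the method\<close>

abbreviation block_residual :: "real^'n^'m \<Rightarrow> real^'m \<Rightarrow> 'm set \<Rightarrow> real^'n \<Rightarrow> real^'m" where
  "block_residual A b J x \<equiv> pos_part (row_block A J *v x - vec_block b J)"

text \<open>In a violated row \<open>j\<close> of the block, feasibility of \<open>y\<close> gives
  \<open>(A x - A y)\<^sub>j \<ge> (A x - b)\<^sub>j\<close>, which is the residual; the other rows have residual zero. So the
  step direction makes an acute angle with the direction from \<open>x\<close> back to any feasible point.\<close>
lemma inner_block_residual_ge:
  assumes "y \<in> feasible_region A b"
  shows "(norm (block_residual A b J x))\<^sup>2
    \<le> (x - y) \<bullet> (transpose (row_block A J) *v block_residual A b J x)"
proof -
  let ?r = "block_residual A b J x"
  have "?r $ j * ?r $ j \<le> ?r $ j * (row_block A J *v (x - y)) $ j" for j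
  proof -
    have "(row_block A J *v (x - y)) $ j = (if j \<in> J then (A *v x) $ j - (A *v y) $ j else 0)"
      by (simp add: matrix_vector_mult_def row_block_def algebra_simps sum_subtractf)
    moreover have "(A *v y) $ j \<le> b $ j"
      using assms by (simp add: feasible_region_def)
    ultimately show ?thesis
      unfolding pos_part_row_block
      by (auto simp: max_def intro!: mult_left_mono)
  qed
  then have "?r \<bullet> ?r \<le> ?r \<bullet> (row_block A J *v (x - y))"
    unfolding inner_vec_def inner_real_def by (intro sum_mono)
  also have "\<dots> = (x - y) \<bullet> (transpose (row_block A J) *v ?r)"
    by (metis inner_transpose_matrix_vector inner_commute)
  finally show ?thesis
    by (simp add: power2_norm_eq_inner)
qed

text \<open>The stepsize divided by the squared Frobenius norm is the factor \<open>c\<close> of the direction \<open>g\<close>.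
  The cross term of the expanded square is controlled by the angle estimate, and the quadratic term
  by the largest singular value of the block.\<close>
lemma grabp_step_descent:
  fixes A :: "real^'n^'m"
  assumes y: "y \<in> feasible_region A b" and "\<alpha> \<ge> 0"
  shows "(norm (grabp_step A b J \<alpha> x - y))\<^sup>2 \<le> (norm (x - y))\<^sup>2
    - (2 * \<alpha> - \<alpha>\<^sup>2 * ((sigma_max (row_block A J))\<^sup>2 / (frobenius_norm (row_block A J))\<^sup>2))
      * ((norm (block_residual A b J x))\<^sup>2 / (frobenius_norm (row_block A J))\<^sup>2)"
proof -
  let ?G = "row_block A J" and ?r = "block_residual A b J x"
  define g where "g = transpose ?G *v ?r"
  define c where "c = \<alpha> / (frobenius_norm ?G)\<^sup>2"
  have "c \<ge> 0"
    using assms(2) by (simp add: c_def)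
  have "(norm g)\<^sup>2 \<le> (sigma_max ?G * norm ?r)\<^sup>2"
    unfolding g_def by (intro power_mono norm_transpose_le_sigma_max) auto
  then have g: "(norm g)\<^sup>2 \<le> (sigma_max ?G)\<^sup>2 * (norm ?r)\<^sup>2"
    by (simp add: power_mult_distrib)
  have "(norm (grabp_step A b J \<alpha> x - y))\<^sup>2 = (norm ((x - y) - c *\<^sub>R g))\<^sup>2"
    by (simp add: grabp_step_def g_def c_def algebra_simps)
  also have "\<dots> = (norm (x - y))\<^sup>2 - 2 * c * ((x - y) \<bullet> g) + c\<^sup>2 * (norm g)\<^sup>2"
    by (simp only: power2_norm_eq_inner)
       (simp add: inner_diff inner_commute algebra_simps power2_eq_square)
  also have "\<dots> \<le> (norm (x - y))\<^sup>2 - 2 * c * (norm ?r)\<^sup>2 + c\<^sup>2 * ((sigma_max ?G)\<^sup>2 * (norm ?r)\<^sup>2)"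
    using inner_block_residual_ge[OF y, of J x] g \<open>c \<ge> 0\<close>
    by (intro add_mono diff_mono mult_left_mono) (auto simp: g_def)
  also have "\<dots> = (norm (x - y))\<^sup>2 - (2 * \<alpha> - \<alpha>\<^sup>2 * ((sigma_max ?G)\<^sup>2 / (frobenius_norm ?G)\<^sup>2))
      * ((norm ?r)\<^sup>2 / (frobenius_norm ?G)\<^sup>2)"
    by (simp add: c_def divide_inverse algebra_simps power2_eq_square)
  finally show ?thesis .
qed


lemma sum_over_partition:
  fixes f :: "'a::finite \<Rightarrow> real"
  assumes "partition_on UNIV (I ` T)" "inj_on I T"
  shows "(\<Sum>i\<in>T. \<Sum>j\<in>I i. f j) = (\<Sum>j\<in>UNIV. f j)"
proof -
  have "(\<Sum>i\<in>T. \<Sum>j\<in>I i. f j) = (\<Sum>J\<in>I ` T. \<Sum>j\<in>J. f j)"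
    using assms(2) by (simp add: sum.reindex)
  also have "\<dots> = (\<Sum>j\<in>\<Union>(I ` T). f j)"
    using partition_onD2[OF assms(1)]
    by (subst sum.Union_disjoint_sets) (auto simp: disjoint_def)
  finally show ?thesis
    by (simp only: partition_onD1[OF assms(1), symmetric])
qed

lemma norm_block_residual:
  "(norm (block_residual A b J x))\<^sup>2 = (\<Sum>j\<in>J. (pos_part (A *v x - b) $ j)\<^sup>2)"
  unfolding power2_norm_eq_inner inner_vec_def
  by (simp add: pos_part_row_block if_distrib[of "\<lambda>a. a * _"] sum.If_cases power2_eq_square cong: if_cong)
     (simp add: pos_part_def)

lemma sum_norm_block_residual:
  assumes "partition_on UNIV (I ` T)" "inj_on I T"
  shows "(\<Sum>i\<in>T. (norm (block_residual A b (I i) x))\<^sup>2) = (norm (pos_part (A *v x - b)))\<^sup>2"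
  by (simp add: norm_block_residual sum_over_partition[OF assms])
     (simp add: power2_norm_eq_inner inner_vec_def flip: power2_eq_square)

lemma sum_frobenius_row_block:
  assumes "partition_on UNIV (I ` T)" "inj_on I T"
  shows "(\<Sum>i\<in>T. (frobenius_norm (row_block A (I i)))\<^sup>2) = (frobenius_norm A)\<^sup>2"
  by (simp add: frobenius_norm_row_block sum_nonneg sum_over_partition[OF assms])
     (simp add: frobenius_norm_def sum_nonneg)

lemma pos_part_residual_eq_0_iff:
  "pos_part (A *v x - b) = 0 \<longleftrightarrow> x \<in> feasible_region A b"
proof -
  have "max 0 c = 0 \<longleftrightarrow> c \<le> 0" for c :: real by auto
  then show ?thesis
    by (simp add: pos_part_def feasible_region_def vec_eq_iff)
qed

lemma frobenius_norm_row_block_pos: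
  assumes "\<And>j. row j A \<noteq> 0" "J \<noteq> {}"
  shows "frobenius_norm (row_block A J) > 0"
proof -
  obtain j where "j \<in> J" using assms(2) by blast
  then have "row_block A J $ j = row j A"
    by (simp add: row_block_def row_def vec_eq_iff)
  then have "row_block A J \<noteq> 0"
    using assms(1)[of j] by auto
  then show ?thesis by (simp add: frobenius_norm_eq_norm)
qed

text \<open>A maximum of ratios is at least the ratio of the sums of numerators and denominators, which by
  the partition are the full squared residual and the full squared Frobenius norm. So the mean of
  this maximum and this ratio, which defines candidates, is also at least this ratio.\<close>
lemma candidate_residual_ge:
  fixes A :: "real^'n^'m"
  assumes rows: "\<And>j. row j A \<noteq> 0"
    and part: "partition_on UNIV (I ` {1..t})" "inj_on I {1..t}"
    and x: "x \<notin> feasible_region A b"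
    and i: "i \<in> grabp_candidates A b t I x"
  shows "(norm (pos_part (A *v x - b)))\<^sup>2 / (frobenius_norm A)\<^sup>2
    \<le> (norm (block_residual A b (I i) x))\<^sup>2 / (frobenius_norm (row_block A (I i)))\<^sup>2"
proof -
  define R where "R = (norm (pos_part (A *v x - b)))\<^sup>2"
  define F where "F = (\<lambda>i. (frobenius_norm (row_block A (I i)))\<^sup>2)"
  define q where "q = (\<lambda>i. (norm (block_residual A b (I i) x))\<^sup>2 / F i)"
  define m where "m = Max (q ` {1..t})"
  have F: "F i > 0" if "i \<in> {1..t}" for i
    using frobenius_norm_row_block_pos[OF rows, of "I i"] partition_onD3[OF part(1)] that
    by (force simp: F_def)
  have sumF: "(\<Sum>i\<in>{1..t}. F i) = (frobenius_norm A)\<^sup>2"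
    unfolding F_def by (rule sum_frobenius_row_block[OF part])
  have it: "i \<in> {1..t}"
    using i by (simp add: grabp_candidates_def)
  have A: "(frobenius_norm A)\<^sup>2 > 0"
    unfolding sumF[symmetric] using F it by (intro sum_pos) auto
  have R: "R > 0"
    using x by (simp add: R_def pos_part_residual_eq_0_iff)
  have "R = (\<Sum>i\<in>{1..t}. (norm (block_residual A b (I i) x))\<^sup>2)"
    unfolding R_def by (rule sum_norm_block_residual[OF part, symmetric])
  also have "\<dots> = (\<Sum>i\<in>{1..t}. q i * F i)"
    using F by (intro sum.cong refl) (simp add: q_def less_imp_neq[symmetric])
  also have "\<dots> \<le> (\<Sum>i\<in>{1..t}. m * F i)"
    using F by (intro sum_mono mult_right_mono) (auto simp: m_def less_imp_le)
  also have "\<dots> = m * (frobenius_norm A)\<^sup>2"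
    by (simp only: sumF flip: sum_distrib_left)
  finally have avg: "R / (frobenius_norm A)\<^sup>2 \<le> m"
    using A by (simp add: pos_divide_le_eq)
  have "grabp_eps A b t I x * R * F i \<le> (norm (block_residual A b (I i) x))\<^sup>2"
    using i by (simp add: grabp_candidates_def R_def F_def)
  then have "grabp_eps A b t I x * R \<le> q i"
    using F[OF it] by (simp add: q_def pos_le_divide_eq)
  moreover have "grabp_eps A b t I x * R = (m + R / (frobenius_norm A)\<^sup>2) / 2"
    using R unfolding grabp_eps_def m_def q_def F_def R_def[symmetric]
    by (simp add: field_simps)
  ultimately show ?thesis
    using avg by (simp add: q_def R_def F_def)
qed

section \<open>Contraction of the distance to the feasible region\<close>

lemma feasible_region_eq_Inter:
  "feasible_region A b = (\<Inter>j. {x. row j A \<bullet> x \<le> b $ j})"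
  by (auto simp: feasible_region_def matrix_vector_mul_component row_def vec_nth_inverse)

lemma closed_feasible_region: "closed (feasible_region A b)"
  unfolding feasible_region_eq_Inter by (intro closed_INT ballI closed_halfspace_le)

lemma convex_feasible_region: "convex (feasible_region A b)"
  unfolding feasible_region_eq_Inter by (intro convex_INT convex_halfspace_le)

definition sq_dist_feasible :: "real^'n^'m \<Rightarrow> real^'m \<Rightarrow> real^'n \<Rightarrow> real" where
  "sq_dist_feasible A b x = (norm (x - closest_point (feasible_region A b) x))\<^sup>2"

lemma sq_dist_feasible_le:
  assumes "y \<in> feasible_region A b"
  shows "sq_dist_feasible A b x \<le> (norm (x - y))\<^sup>2"
  using closest_point_le[OF closed_feasible_region assms, of x]
  by (simp add: sq_dist_feasible_def dist_norm power_mono)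

lemma sq_dist_feasible_eq_0: "x \<in> feasible_region A b \<Longrightarrow> sq_dist_feasible A b x = 0"
  by (simp add: sq_dist_feasible_def closest_point_self)

text \<open>The distance of the new iterate to the feasible region is at most its distance to the old
  projection \<open>y\<close>, for which the descent estimate, the greedy choice and the Hoffman bound combine.
  They combine because the factor \<open>2 \<alpha> - \<alpha>\<^sup>2 \<zeta>\<close> is nonnegative for stepsizes below \<open>2 / \<zeta>\<close>.\<close>
lemma grabp_step_contracts:
  fixes A :: "real^'n^'m"
  assumes rows: "\<And>j. row j A \<noteq> 0"
    and nonempty: "feasible_region A b \<noteq> {}"
    and part: "partition_on UNIV (I ` {1..t})" "inj_on I {1..t}"
    and zeta: "\<zeta> = Max ((\<lambda>i. (sigma_max (row_block A (I i)))\<^sup>2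
                              / (frobenius_norm (row_block A (I i)))\<^sup>2) ` {1..t})"
    and hoffman: "hoffman_constant A b L"
    and alpha: "\<alpha> \<in> {0<..<2 / \<zeta>}"
    and x: "x \<notin> feasible_region A b"
    and i: "i \<in> grabp_candidates A b t I x"
  shows "sq_dist_feasible A b (grabp_step A b (I i) \<alpha> x)
    \<le> (1 - (2 * \<alpha> - \<alpha>\<^sup>2 * \<zeta>) / (L\<^sup>2 * (frobenius_norm A)\<^sup>2)) * sq_dist_feasible A b x"
proof -
  define d where "d = sq_dist_feasible A b x"
  define R where "R = (norm (pos_part (A *v x - b)))\<^sup>2"
  define z where "z = (sigma_max (row_block A (I i)))\<^sup>2 / (frobenius_norm (row_block A (I i)))\<^sup>2"
  define q where "q = (norm (block_residual A b (I i) x))\<^sup>2 / (frobenius_norm (row_block A (I i)))\<^sup>2"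
  define y where "y = closest_point (feasible_region A b) x"
  have y: "y \<in> feasible_region A b"
    unfolding y_def by (rule closest_point_in_set[OF closed_feasible_region nonempty])
  have d: "d = (norm (x - y))\<^sup>2"
    by (simp add: d_def sq_dist_feasible_def y_def)
  have "\<alpha> > 0"
    using alpha by simp
  \<comment> \<open>Otherwise \<open>2 / \<zeta> \<le> 0\<close>, by the convention \<open>2 / 0 = 0\<close> when \<open>\<zeta> = 0\<close>, and no stepsize would
    be admissible.\<close>
  have "\<alpha> < 2 / \<zeta>"
    using alpha by simp
  with \<open>\<alpha> > 0\<close> have "0 < 2 / \<zeta>"
    by (rule less_trans)
  then have "\<zeta> > 0"
    by (simp add: zero_less_divide_iff)
  then have "\<alpha> * \<zeta> \<le> 2"
    using alpha by (simp add: pos_less_divide_eq)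
  then have "0 \<le> \<alpha> * (2 - \<alpha> * \<zeta>)"
    using \<open>\<alpha> > 0\<close> by simp
  then have gain: "0 \<le> 2 * \<alpha> - \<alpha>\<^sup>2 * \<zeta>"
    by (simp add: algebra_simps power2_eq_square)
  have "z \<le> \<zeta>"
    unfolding zeta z_def using i by (intro Max_ge) (auto simp: grabp_candidates_def)
  have "L > 0" and "d \<le> L\<^sup>2 * R"
    using hoffman by (auto simp: hoffman_constant_def d_def R_def sq_dist_feasible_def)
  then have "d / L\<^sup>2 \<le> R"
    by (simp add: pos_divide_le_eq mult.commute)
  then have "d / L\<^sup>2 / (frobenius_norm A)\<^sup>2 \<le> R / (frobenius_norm A)\<^sup>2"
    by (intro divide_right_mono) auto
  also have "\<dots> \<le> q"
    unfolding q_def R_def by (rule candidate_residual_ge[OF rows part x i])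
  finally have q: "d / L\<^sup>2 / (frobenius_norm A)\<^sup>2 \<le> q" .
  have "sq_dist_feasible A b (grabp_step A b (I i) \<alpha> x)
      \<le> (norm (grabp_step A b (I i) \<alpha> x - y))\<^sup>2"
    by (rule sq_dist_feasible_le[OF y])
  also have "\<dots> \<le> d - (2 * \<alpha> - \<alpha>\<^sup>2 * z) * q"
    unfolding d z_def q_def using \<open>\<alpha> > 0\<close> by (intro grabp_step_descent[OF y]) simp
  also have "\<dots> \<le> d - (2 * \<alpha> - \<alpha>\<^sup>2 * \<zeta>) * q"
    using \<open>z \<le> \<zeta>\<close> by (intro diff_left_mono mult_right_mono mult_left_mono) (auto simp: q_def)
  also have "\<dots> \<le> d - (2 * \<alpha> - \<alpha>\<^sup>2 * \<zeta>) * (d / L\<^sup>2 / (frobenius_norm A)\<^sup>2)"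
    by (intro diff_left_mono mult_left_mono q gain)
  also have "\<dots> = (1 - (2 * \<alpha> - \<alpha>\<^sup>2 * \<zeta>) / (L\<^sup>2 * (frobenius_norm A)\<^sup>2)) * d"
    by (simp add: left_diff_distrib)
  finally show ?thesis
    by (simp add: d_def)
qed

section \<open>Measurability\<close>

lemma continuous_on_pos_part [continuous_intros]:
  assumes "continuous_on X f"
  shows "continuous_on X (\<lambda>x. pos_part (f x))"
  unfolding pos_part_def
  by (intro continuous_on_vec_lambda continuous_on_max continuous_intros assms)

lemma borel_measurable_grabp_step: "grabp_step A b J \<alpha> \<in> borel_measurable borel"
  unfolding grabp_step_def transpose_row_block_mult
  by (intro borel_measurable_continuous_onI continuous_intros)

lemma sets_grabp_candidates: "{x. i \<in> grabp_candidates A b t I x} \<in> sets borel"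
proof -
  have [measurable]: "(\<lambda>x. (norm (block_residual A b J x))\<^sup>2) \<in> borel_measurable borel" for J
    by (intro borel_measurable_continuous_onI continuous_intros)
  have [measurable]: "(\<lambda>x. (norm (pos_part (A *v x - b)))\<^sup>2) \<in> borel_measurable borel"
    by (intro borel_measurable_continuous_onI continuous_intros)
  have [measurable]: "grabp_eps A b t I \<in> borel_measurable borel"
    unfolding grabp_eps_def by measurable
  show ?thesis
    unfolding grabp_candidates_def by measurable
qed

lemma borel_measurable_sq_dist_feasible:
  assumes "feasible_region A b \<noteq> {}"
  shows "sq_dist_feasible A b \<in> borel_measurable borel"
  unfolding sq_dist_feasible_def
  using continuous_on_closest_point[OF convex_feasible_region closed_feasible_region assms]
  by (intro borel_measurable_continuous_onI continuous_intros)

section \<open>The drawn index\<close>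

context grabp
begin

lemma space_history [simp]: "space (history M idx k) = space M"
  by (simp add: history_def space_measure_of_conv)

lemma idx_measurable_history:
  assumes "l < k"
  shows "idx l \<in> measurable (history M idx k) (count_space UNIV)"
proof (rule measurableI)
  fix B :: "nat set"
  have "idx l -` B \<inter> space M \<in> sigma_sets (space M) {idx l -` B \<inter> space M |l B. l < k}"
    using assms by (intro sigma_sets.Basic) blast
  then show "idx l -` B \<inter> space (history M idx k) \<in> sets (history M idx k)"
    unfolding space_history unfolding history_def by (subst sets_measure_of) auto
qed simp

lemma subalgebra_history: "subalgebra M (history M idx k)"
proof -
  have "idx l -` B \<inter> space M \<in> sets M" for l B
    using idx_measurable by (rule measurable_sets) simp
  then have "sigma_sets (space M) {idx l -` B \<inter> space M |l B. l < k} \<subseteq> sets M"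
    by (intro sets.sigma_sets_subset) blast
  then show ?thesis
    unfolding subalgebra_def space_history
    unfolding history_def by (subst sets_measure_of) auto
qed

text \<open>The iterate before the draw of \<open>idx k\<close> is determined by the earlier indices, since the initial
  point is constant. This is what allows integration over events about \<open>x k\<close> against the conditional
  law of \<open>idx k\<close>.\<close>
lemma x_measurable_history:
  assumes "l \<le> k"
  shows "x l \<in> borel_measurable (history M idx k)"
  using assms
proof (induction l)
  case 0
  have "(\<lambda>_. x0) \<in> borel_measurable (history M idx k)"
    by simp
  then show ?case
    by (rule measurable_cong[THEN iffD1, rotated]) (simp add: x_init)
next
  case (Suc l)
  let ?H = "history M idx k"
  have x [measurable]: "x l \<in> borel_measurable ?H"
    using Suc by simp
  have idx: "idx l \<in> measurable ?H (count_space UNIV)"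
    using Suc.prems by (intro idx_measurable_history) simp
  have step: "(\<lambda>\<omega>. grabp_step A b (I i) (\<alpha> l) (x l \<omega>)) \<in> borel_measurable ?H" for i
    by (rule measurable_compose[OF x borel_measurable_grabp_step])
  have [measurable]: "(\<lambda>\<omega>. grabp_step A b (I (idx l \<omega>)) (\<alpha> l) (x l \<omega>)) \<in> borel_measurable ?H"
    by (rule measurable_compose_countable[OF step idx])
  have [measurable]: "feasible_region A b \<in> sets borel"
    by (intro borel_closed closed_feasible_region)
  have "(\<lambda>\<omega>. if x l \<omega> \<in> feasible_region A b then x l \<omega>
      else grabp_step A b (I (idx l \<omega>)) (\<alpha> l) (x l \<omega>)) \<in> borel_measurable ?H"
    by measurable
  then show ?case
    by (rule measurable_cong[THEN iffD1, rotated]) (simp add: x_step)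
qed

lemma x_measurable: "x k \<in> borel_measurable M"
  using measurable_from_subalg[OF subalgebra_history x_measurable_history] by blast

text \<open>Let \<open>G\<close> be the event that \<open>x k\<close> is infeasible and \<open>W\<close> the part of it on which a candidate is
  drawn. Split \<open>W\<close> according to the drawn index: it is the disjoint union of the sets where \<open>i\<close> is
  drawn, intersected with the events \<open>U i\<close> that \<open>i\<close> is a candidate. The latter belong to the
  history, so the conditional probabilities may replace the indicators of the draws; they sum to one
  over the candidates. Hence \<open>W\<close> and \<open>G\<close> have the same probability.\<close>
lemma AE_idx_in_candidates:
  "AE \<omega> in M. x k \<omega> \<notin> feasible_region A b \<longrightarrow> idx k \<omega> \<in> grabp_candidates A b t I (x k \<omega>)"
proof -
  let ?H = "history M idx k" and ?T = "{1..t}"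
  interpret H: finite_measure_subalgebra M ?H
    by unfold_locales (rule subalgebra_history)
  define cand where "cand = (\<lambda>\<omega>. grabp_candidates A b t I (x k \<omega>))"
  define G where "G = {\<omega> \<in> space M. x k \<omega> \<notin> feasible_region A b}"
  define U where "U = (\<lambda>i. {\<omega> \<in> space M. x k \<omega> \<notin> feasible_region A b \<and> i \<in> cand \<omega>})"
  define D where "D = (\<lambda>i. {\<omega> \<in> space M. idx k \<omega> = i})"
  define W where "W = {\<omega> \<in> G. idx k \<omega> \<in> cand \<omega>}"
  define ce where "ce = (\<lambda>i. real_cond_exp M ?H (indicator (D i)))"
  have cand: "cand \<omega> \<subseteq> ?T" for \<omega>
    by (auto simp: cand_def grabp_candidates_def)
  have x [measurable]: "x k \<in> borel_measurable ?H" "x k \<in> borel_measurable M"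
    by (simp_all add: x_measurable_history x_measurable)
  have [measurable]: "idx k \<in> measurable M (count_space UNIV)"
    by (rule idx_measurable)
  have [measurable]: "feasible_region A b \<in> sets borel"
    by (intro borel_closed closed_feasible_region)
  have [measurable]: "{y. i \<in> grabp_candidates A b t I y} \<in> sets borel" for i
    by (rule sets_grabp_candidates)
  have "{\<omega> \<in> space ?H. x k \<omega> \<notin> feasible_region A b \<and> x k \<omega> \<in> {y. i \<in> grabp_candidates A b t I y}} \<in> sets ?H" for i
    by measurable
  then have UH: "U i \<in> sets ?H" for i
    by (simp add: U_def cand_def)
  have UM: "U i \<in> sets M" for i
    using UH subalgebra_history by (auto simp: subalgebra_def)
  have DM: "D i \<in> sets M" for i
    unfolding D_def by measurable
  have GM: "G \<in> sets M"
    unfolding G_def by measurable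
  have W_sum: "indicator W \<omega> = (\<Sum>i\<in>?T. indicator (U i) \<omega> * indicator (D i) \<omega> :: real)"
    if "\<omega> \<in> space M" for \<omega>
  proof -
    have "(\<Sum>i\<in>?T. indicator (U i) \<omega> * indicator (D i) \<omega> :: real)
        = (\<Sum>i\<in>?T. if i = idx k \<omega> then indicator W \<omega> else 0)"
      using that by (intro sum.cong) (auto simp: U_def D_def W_def G_def indicator_def)
    also have "\<dots> = indicator W \<omega>"
      using cand[of \<omega>] by (auto simp: W_def indicator_def)
    finally show ?thesis by simp
  qed
  have "W = (\<Union>i\<in>?T. U i \<inter> D i)"
    using cand by (auto simp: W_def G_def U_def D_def)
  then have WM: "W \<in> sets M"
    using UM DM by auto
  have intUD: "integrable M (\<lambda>\<omega>. indicator (U i) \<omega> * indicator (D i) \<omega> :: real)" for i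
    using UM DM by (subst mult.commute, intro integrable_real_mult_indicator) (auto simp: emeasure_eq_measure)
  have ce_int: "integrable M (\<lambda>\<omega>. indicator (U i) \<omega> * ce i \<omega>)"
    and ce_eq: "(\<integral>\<omega>. indicator (U i) \<omega> * ce i \<omega> \<partial>M) = (\<integral>\<omega>. indicator (U i) \<omega> * indicator (D i) \<omega> \<partial>M)" for i
    using H.real_cond_exp_intg[OF intUD, of i] UH DM by (auto simp: ce_def)
  have "AE \<omega> in M. \<forall>i\<in>?T. x k \<omega> \<notin> feasible_region A b \<longrightarrow> ce i \<omega> = p k i \<omega>"
    unfolding ce_def D_def by (intro AE_finite_allI idx_law) auto
  then have AE_G: "AE \<omega> in M. (\<Sum>i\<in>?T. indicator (U i) \<omega> * ce i \<omega>) = indicator G \<omega>"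
    using AE_space
  proof eventually_elim
    case (elim \<omega>)
    show ?case
    proof (cases "\<omega> \<in> G")
      case True
      then have inf: "x k \<omega> \<notin> feasible_region A b" by (simp add: G_def)
      have "(\<Sum>i\<in>?T. indicator (U i) \<omega> * ce i \<omega>) = (\<Sum>i\<in>?T. if i \<in> cand \<omega> then p k i \<omega> else 0)"
        using elim inf by (intro sum.cong) (auto simp: U_def)
      also have "\<dots> = (\<Sum>i\<in>cand \<omega>. p k i \<omega>)"
        using cand[of \<omega>] by (simp add: sum.If_cases Int_absorb1)
      also have "\<dots> = 1"
        unfolding cand_def by (rule p_sum[OF elim(2) inf])
      finally show ?thesis using True by simp
    next
      case False
      then show ?thesis using elim(2) by (simp add: U_def G_def)
    qed
  qed
  have "prob W = (\<integral>\<omega>. indicator W \<omega> \<partial>M)"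
    using WM by simp
  also have "\<dots> = (\<integral>\<omega>. (\<Sum>i\<in>?T. indicator (U i) \<omega> * indicator (D i) \<omega>) \<partial>M)"
    by (intro Bochner_Integration.integral_cong refl W_sum)
  also have "\<dots> = (\<integral>\<omega>. (\<Sum>i\<in>?T. indicator (U i) \<omega> * ce i \<omega>) \<partial>M)"
    by (simp only: Bochner_Integration.integral_sum intUD ce_int ce_eq)
  also have "\<dots> = (\<integral>\<omega>. indicator G \<omega> \<partial>M)"
    by (intro integral_cong_AE borel_measurable_sum borel_measurable_integrable[OF ce_int]
        borel_measurable_indicator GM AE_G)
  also have "\<dots> = prob G"
    using GM by simp
  finally have "prob (G - W) = 0"
    using GM WM by (subst finite_measure_Diff) (auto simp: W_def)
  then have "G - W \<in> null_sets M"
    using GM WM by (auto simp: emeasure_eq_measure)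
  from AE_not_in[OF this] AE_space show ?thesis
    by eventually_elim (auto simp: G_def W_def cand_def)
qed

end

section \<open>Expected linear convergence\<close>

theorem theorem3p2:
  fixes A :: "real^'n^'m" and b :: "real^'m"
    and t :: nat and I :: "nat \<Rightarrow> 'm set"
    and \<zeta> L \<alpha> :: real and x0 :: "real^'n" and S :: "(real^'n) set"
    and M :: "'w measure" and p :: "nat \<Rightarrow> nat \<Rightarrow> 'w \<Rightarrow> real"
    and idx :: "nat \<Rightarrow> 'w \<Rightarrow> nat" and x :: "nat \<Rightarrow> 'w \<Rightarrow> real^'n" and k :: nat
  assumes S: "S = feasible_region A b"
    and no_zero_rows: "\<And>j. row j A \<noteq> 0"
    and nonempty: "S \<noteq> {}"
    and part: "partition_on UNIV (I ` {1..t})" "inj_on I {1..t}"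
    and zeta: "\<zeta> = Max ((\<lambda>i. (sigma_max (row_block A (I i)))\<^sup>2
                              / (frobenius_norm (row_block A (I i)))\<^sup>2) ` {1..t})"
    and hoffman: "hoffman_constant A b L"
    and alpha: "\<alpha> \<in> {0<..<2 / \<zeta>}"
    and iterates: "grabp M A b t I (\<lambda>_. \<alpha>) x0 p idx x"
  shows "integrable M (\<lambda>\<omega>. (norm (x k \<omega> - closest_point S (x k \<omega>)))\<^sup>2) \<and>
         (\<integral>\<omega>. (norm (x k \<omega> - closest_point S (x k \<omega>)))\<^sup>2 \<partial>M)
           \<le> (1 - (2 * \<alpha> - \<alpha>\<^sup>2 * \<zeta>) / (L\<^sup>2 * (frobenius_norm A)\<^sup>2)) ^ k
              * (norm (x0 - closest_point S x0))\<^sup>2"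
proof -
  interpret grabp M A b t I "\<lambda>_. \<alpha>" x0 p idx x
    by (rule iterates)
  let ?d = "sq_dist_feasible A b"
  define c where "c = 1 - (2 * \<alpha> - \<alpha>\<^sup>2 * \<zeta>) / (L\<^sup>2 * (frobenius_norm A)\<^sup>2)"
  have d_nonneg: "0 \<le> ?d y" for y
    by (simp add: sq_dist_feasible_def)
  have nonempty': "feasible_region A b \<noteq> {}"
    using nonempty S by simp
  have contract: "AE \<omega> in M. ?d (x (Suc k) \<omega>) \<le> c * ?d (x k \<omega>)" for k
    using AE_idx_in_candidates[of k] AE_space
  proof eventually_elim
    case (elim \<omega>)
    show ?case
    proof (cases "x k \<omega> \<in> feasible_region A b")
      case True
      then show ?thesis
        using elim(2) by (simp add: x_step sq_dist_feasible_eq_0)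
    next
      case False
      then show ?thesis
        using elim grabp_step_contracts[OF no_zero_rows nonempty' part zeta hoffman alpha False]
        by (simp add: x_step c_def)
    qed
  qed
  have bound: "AE \<omega> in M. ?d (x k \<omega>) \<le> c ^ k * ?d x0" for k
    \<comment> \<open>The induction step multiplies an inequality by \<open>c\<close>, which must then be nonnegative. The
      first step shows this when it starts at positive distance; otherwise all distances are zero.\<close>
  proof (cases "?d x0 = 0")
    case True
    have "AE \<omega> in M. ?d (x k \<omega>) = 0" for k
    proof (induction k)
      case 0
      show ?case using True by (intro AE_I2) (simp add: x_init)
    next
      case (Suc k)
      from Suc contract[of k] show ?case
        by eventually_elim (use d_nonneg in \<open>simp add: order_antisym\<close>)
    qed
    from this[of k] show ?thesis
      by eventually_elim (simp add: True)
  next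
    case False
    have "AE \<omega> in M. 0 \<le> c"
      using contract[of 0] AE_space
    proof eventually_elim
      case (elim \<omega>)
      then have "0 \<le> c * ?d x0"
        using d_nonneg[of "x (Suc 0) \<omega>"] by (simp add: x_init)
      then show ?case
        using False d_nonneg[of x0] by (simp add: zero_le_mult_iff)
    qed
    then have "c \<ge> 0" by simp
    show ?thesis
    proof (induction k)
      case 0
      show ?case by (intro AE_I2) (simp add: x_init)
    next
      case (Suc k)
      from Suc contract[of k] show ?case
      proof eventually_elim
        case (elim \<omega>)
        have "c * ?d (x k \<omega>) \<le> c * (c ^ k * ?d x0)"
          using elim(1) \<open>c \<ge> 0\<close> by (rule mult_left_mono)
        with elim(2) show ?case by simp
      qed
    qed
  qed
  have "(\<lambda>\<omega>. ?d (x k \<omega>)) \<in> borel_measurable M"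
    by (rule measurable_compose[OF x_measurable borel_measurable_sq_dist_feasible[OF nonempty']])
  then have int: "integrable M (\<lambda>\<omega>. ?d (x k \<omega>))"
    using bound[of k] d_nonneg by (intro integrable_const_bound[where B = "c ^ k * ?d x0"]) auto
  moreover have "(\<integral>\<omega>. ?d (x k \<omega>) \<partial>M) \<le> c ^ k * ?d x0"
    by (rule integral_le_const[OF int bound])
  ultimately show ?thesis
    by (simp add: sq_dist_feasible_def S c_def)
qed

end
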